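(* Let $X$ be a finite set with $n\geq 1$ elements and let $m=\lfloor n/2\rfloor$. Then: (1) If $n<10$, then the maximum cardinality of a commutative subsemigroup of $\mathcal{I}(X)$ is $2^n$, and the semilattice $E(\mathcal{I}(X))$ of idempotents of $\mathcal{I}(X)$ is the unique commutative subsemigroup of $\mathcal{I}(X)$ of order $2^n$. (2) Suppose $n\geq 10$. Then the maximum cardinality of a commutative subsemigroup of $\mathcal{I}(X)$ is $$\lambda_n+1=\sum_{r=0}^m\binom{m}{r}\binom{n-m}{r}r!+1.$$ (a) If $n$ is even, then there are exactly $\binom{n}{m}$, pairwise isomorphic, commutative subsemigroups of $\mathcal{I}(X)$ of order $\lambda_n+1$, namely the balanced null monoids $S_{K,L}\cup\{1\}$. (b) If $n$ is odd, then there are exactly $2\binom{n}{m}$, pairwise isomorphic, commutative subsemigroups of $\mathcal{I}(X)$ of order $\lambda_n+1$, namely the balanced null monoids $S_{K,L}\cup\{1\}$.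
   Context: For a finite set $X$, $\mathcal{I}(X)$ is the symmetric inverse semigroup on $X$: all partial injective transformations of $X$ (injective functions whose domain and image are subsets of $X$) under composition of partial functions, written from left to right. Its identity (the identity map on $X$) is denoted $1$, and its zero (the empty map) is denoted $0$. For $n=|X|\geq 2$ and a partition $\{K,L\}$ of $X$ into two nonempty sets, $S_{K,L}$ is the set of all $\alpha\in\mathcal{I}(X)$ with $\operatorname{dom}(\alpha)\subseteq K$ and $\operatorname{im}(\alpha)\subseteq L$ (including $0$). It is a semigroup in which every product is $0$. It is called balanced if $|K|=\lfloor n/2\rfloor$ and $|L|=n-\lfloor n/2\rfloor$, or vice versa; in this case $S_{K,L}\cup\{1\}$ is called a balanced null monoid. Here $\lambda_n=\sum_{r=0}^{\lfloor n/2\rfloor}\binom{\lfloor n/2\rfloor}{r}\binom{n-\lfloor n/2\rfloor}{r}r!$. *)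

theory Defs
  imports "HOL-Algebra.Group"
begin

text \<open>
  Partial transformations of \<open>X\<close> are partial maps whose domain and range lie in \<open>X\<close>.
  Composition is written from left to right, i.e. \<open>\<alpha> \<otimes> \<beta>\<close> applies \<open>\<alpha>\<close> first,
  whereas \<open>\<circ>\<^sub>m\<close> composes from right to left.
\<close>

definition sym_inv :: "'a set \<Rightarrow> ('a \<rightharpoonup> 'a) monoid" where
  "sym_inv X =
     \<lparr>carrier = {\<alpha>. dom \<alpha> \<subseteq> X \<and> ran \<alpha> \<subseteq> X \<and> inj_on \<alpha> (dom \<alpha>)},
      mult = (\<lambda>\<alpha> \<beta>. \<beta> \<circ>\<^sub>m \<alpha>),
      one = Some |` X\<rparr>"

definition comm_subsemigroups :: "('b, 'c) monoid_scheme \<Rightarrow> 'b set set" where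
  "comm_subsemigroups G =
     {S. S \<noteq> {} \<and> S \<subseteq> carrier G \<and>
         (\<forall>a\<in>S. \<forall>b\<in>S. a \<otimes>\<^bsub>G\<^esub> b \<in> S) \<and>
         (\<forall>a\<in>S. \<forall>b\<in>S. a \<otimes>\<^bsub>G\<^esub> b = b \<otimes>\<^bsub>G\<^esub> a)}"

definition idempotents :: "('b, 'c) monoid_scheme \<Rightarrow> 'b set" where
  "idempotents G = {e \<in> carrier G. e \<otimes>\<^bsub>G\<^esub> e = e}"

text \<open>
  Isomorphism of subsemigroups \<open>S\<close>, \<open>T\<close> of \<open>G\<close>. The relation \<open>\<cong>\<close> only asks for a bijection
  of the carriers that preserves multiplication, so it is meaningful for semigroups;
  the unit field of the record plays no role in it.
\<close>

definition iso_subsemigroups :: "('b, 'c) monoid_scheme \<Rightarrow> 'b set \<Rightarrow> 'b set \<Rightarrow> bool" where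
  "iso_subsemigroups G S T \<longleftrightarrow> G\<lparr>carrier := S\<rparr> \<cong> G\<lparr>carrier := T\<rparr>"

definition null_semigroup :: "'a set \<Rightarrow> 'a set \<Rightarrow> 'a set \<Rightarrow> ('a \<rightharpoonup> 'a) set" where
  "null_semigroup X K L = {\<alpha> \<in> carrier (sym_inv X). dom \<alpha> \<subseteq> K \<and> ran \<alpha> \<subseteq> L}"

definition balanced_partition :: "'a set \<Rightarrow> 'a set \<Rightarrow> 'a set \<Rightarrow> bool" where
  "balanced_partition X K L \<longleftrightarrow>
     K \<union> L = X \<and> K \<inter> L = {} \<and> K \<noteq> {} \<and> L \<noteq> {} \<and>
     (card K = card X div 2 \<and> card L = card X - card X div 2 \<or>
      card L = card X div 2 \<and> card K = card X - card X div 2)"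

definition balanced_null_monoids :: "'a set \<Rightarrow> ('a \<rightharpoonup> 'a) set set" where
  "balanced_null_monoids X =
     {null_semigroup X K L \<union> {\<one>\<^bsub>sym_inv X\<^esub>} | K L. balanced_partition X K L}"

definition lambda_num :: "nat \<Rightarrow> nat" where
  "lambda_num n =
     (\<Sum>r = 0..n div 2. ((n div 2) choose r) * ((n - n div 2) choose r) * fact r)"

text \<open>
  For finite \<open>X\<close>, the maximum \<open>Max (card ` comm_subsemigroups (sym_inv X))\<close> is taken
  over a finite nonempty set.
\<close>

lemma finite_carrier_sym_inv:
  assumes "finite X"
  shows "finite (carrier (sym_inv X))"
proof -
  have "carrier (sym_inv X) \<subseteq> (\<Union>D\<in>Pow X. {\<alpha>. dom \<alpha> = D \<and> ran \<alpha> \<subseteq> X})"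
    by (auto simp: sym_inv_def)
  moreover have "finite (\<Union>D\<in>Pow X. {\<alpha>::'a \<rightharpoonup> 'a. dom \<alpha> = D \<and> ran \<alpha> \<subseteq> X})"
    using assms by (auto intro: finite_set_of_finite_maps finite_subset)
  ultimately show ?thesis
    by (rule finite_subset)
qed

lemma finite_comm_subsemigroups:
  assumes "finite X"
  shows "finite (comm_subsemigroups (sym_inv X))"
  by (rule finite_subset[of _ "Pow (carrier (sym_inv X))"])
     (auto simp: comm_subsemigroups_def finite_carrier_sym_inv[OF assms])

lemma comm_subsemigroups_nonempty: "comm_subsemigroups (sym_inv X) \<noteq> {}"
proof -
  have "{Map.empty} \<in> comm_subsemigroups (sym_inv X)"
    by (auto simp: comm_subsemigroups_def sym_inv_def)
  then show ?thesis by blast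
qed

end

theory Submission
  imports Defs
begin

text \<open>
  Let \<open>S\<close> be a commutative subsemigroup, and call \<open>Y \<subseteq> X\<close> invariant if no element of \<open>S\<close> maps a
  point across the boundary of \<open>Y\<close>, in either direction. If there is a proper nonempty invariant
  \<open>Y\<close>, then \<open>S\<close> embeds into the product of its restrictions to \<open>Y\<close> and \<open>X - Y\<close>, and induction on
  \<open>|X|\<close> applies, because \<open>B(a) B(b) \<le> B(a + b)\<close> for \<open>B(n) = max (2^n) (\<lambda>\<^sub>n + 1)\<close>, strictly
  if \<open>a + b \<ge> 10\<close>.

  Otherwise adjoin \<open>1\<close> to \<open>S\<close>. The fixed points of an element form an invariant set, so only \<open>1\<close>
  has fixed points. Take a minimal set \<open>A\<close> from which \<open>S\<close> reaches all of \<open>X\<close>. By minimality no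
  element of \<open>A\<close> is reachable from another one, so every \<open>\<alpha> \<noteq> 1\<close> maps \<open>A\<close> into \<open>X - A\<close>. If \<open>y = x\<gamma>\<close>
  with \<open>x \<in> A\<close>, then \<open>y\<alpha> = (x\<alpha>)\<gamma>\<close>, so \<open>\<alpha>\<close> is determined by its restriction to \<open>A\<close>. Hence
  \<open>|S| - 1\<close> is at most the number of partial injections from \<open>A\<close> to \<open>X - A\<close>, which is at most \<open>\<lambda>\<^sub>n\<close>,
  with equality only if \<open>A\<close> is balanced and every partial injection occurs as a restriction.
\<close>

section \<open>Counting partial injections by recursion and by binomial sums\<close>

text \<open>The number of partial injections from an \<open>a\<close>-set to a \<open>b\<close>-set:
  in the last equation the newest target point is either missed or hit from one of
  \<open>Suc a\<close> points. \<open>card_partial_injections\<close> confirms this reading.\<close>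

fun pinj_num :: "nat \<Rightarrow> nat \<Rightarrow> nat" where
  "pinj_num a 0 = 1"
| "pinj_num 0 (Suc b) = 1"
| "pinj_num (Suc a) (Suc b) = pinj_num (Suc a) b + Suc a * pinj_num a b"

lemma pinj_num_0 [simp]: "pinj_num 0 b = 1"
  by (cases b) auto

lemma pinj_num_pos [simp]: "0 < pinj_num a b"
  by (induction a b rule: pinj_num.induct) auto

text \<open>Termwise, Pascal's rule splits \<open>Suc b choose Suc r\<close>, and the absorption
  identity \<open>Suc_times_binomial\<close> turns the second half into \<open>Suc a\<close> times
  the \<open>r\<close>-th term for \<open>a\<close> and \<open>b\<close>. The terms for
  \<open>r = 0\<close> agree.\<close>

lemma sum_choose_fact_rec:
  "(\<Sum>r\<le>Suc a. (Suc a choose r) * (Suc b choose r) * fact r) =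
     (\<Sum>r\<le>Suc a. (Suc a choose r) * (b choose r) * fact r) +
     Suc a * (\<Sum>r\<le>a. (a choose r) * (b choose r) * (fact r :: nat))"
proof -
  have "(Suc a choose Suc r) * (Suc b choose Suc r) * fact (Suc r) =
     (Suc a choose Suc r) * (b choose Suc r) * fact (Suc r) +
     Suc a * ((a choose r) * (b choose r) * (fact r :: nat))" for r
  proof -
    have "Suc r * (Suc a choose Suc r) = Suc a * (a choose r)"
      by (rule Suc_times_binomial)
    then have "(Suc a choose Suc r) * (b choose r) * (Suc r * fact r) =
        Suc a * ((a choose r) * (b choose r) * (fact r :: nat))"
      by (metis mult.assoc mult.commute)
    then show ?thesis
      by (simp only: binomial_Suc_Suc[of b r] fact_Suc of_nat_id distrib_left distrib_right)
  qed
  then show ?thesis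
    by (simp only: sum.atMost_Suc_shift sum.distrib sum_distrib_left) simp
qed

lemma pinj_num_eq_sum:
  "pinj_num a b = (\<Sum>r\<le>a. (a choose r) * (b choose r) * fact r)"
proof (induction a b rule: pinj_num.induct)
  case (1 a)
  have "(a choose r) * (0 choose r) * fact r = (if r = 0 then 1 else 0 :: nat)" for r
    by (cases r) auto
  then show ?case by simp
qed (simp_all only: pinj_num.simps sum_choose_fact_rec, simp)

text \<open>Terms beyond \<open>min a b\<close> vanish. The symmetric range of summation yields
  \<open>pinj_num_commute\<close>, which the recursion hides.\<close>

lemma pinj_num_eq_sum_min:
  "pinj_num a b = (\<Sum>r\<le>min a b. (a choose r) * (b choose r) * fact r)"
  unfolding pinj_num_eq_sum by (rule sum.mono_neutral_right) auto

lemma pinj_num_commute: "pinj_num a b = pinj_num b a"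
  by (simp add: pinj_num_eq_sum_min min.commute mult.commute mult.left_commute)

lemma pinj_num_Suc_right: "pinj_num a (Suc b) = pinj_num a b + a * pinj_num (a - 1) b"
  by (cases a) auto

lemma pinj_num_Suc_left: "pinj_num (Suc a) b = pinj_num a b + b * pinj_num a (b - 1)"
  using pinj_num_Suc_right[of b a] by (simp add: pinj_num_commute)

text \<open>Removing the extra point on either side leaves the common summand
  \<open>pinj_num a b\<close>; it remains to compare \<open>a * pinj_num (a - 1) b\<close> with
  \<open>b * pinj_num a (b - 1)\<close>, which the induction hypothesis does.\<close>

lemma pinj_num_shift_le:
  "a \<le> b \<Longrightarrow> pinj_num a (Suc b) \<le> pinj_num (Suc a) b"
proof (induction a arbitrary: b)
  case (Suc a)
  then obtain c where b: "b = Suc c" by (cases b) auto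
  with Suc have "pinj_num a (Suc c) \<le> pinj_num (Suc a) c" by auto
  then have "Suc a * pinj_num a b \<le> b * pinj_num (Suc a) (b - 1)"
    using Suc.prems by (intro mult_mono) (auto simp: b simp del: pinj_num.simps)
  then show ?case
    using pinj_num_Suc_right[of "Suc a" b] pinj_num_Suc_left[of "Suc a" b] by simp
qed (simp add: Suc_le_eq)

text \<open>The same comparison as in \<open>pinj_num_shift_le\<close>; strictness comes from the
  coefficients \<open>a < b\<close>.\<close>

lemma pinj_num_shift_less:
  assumes "a < b"
  shows "pinj_num a (Suc b) < pinj_num (Suc a) b"
proof -
  obtain c where b: "b = Suc c" using assms by (cases b) auto
  have "a * pinj_num (a - 1) b \<le> a * pinj_num a (b - 1)"
  proof (cases a)
    case (Suc d)
    then show ?thesis using pinj_num_shift_le[of d c] assms b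
      by (intro mult_left_mono) (auto simp del: pinj_num.simps)
  qed auto
  also have "\<dots> < b * pinj_num a (b - 1)" using assms by simp
  finally show ?thesis
    using pinj_num_Suc_right[of a b] pinj_num_Suc_left[of a b] by simp
qed

section \<open>Balanced splits maximise the number of partial injections\<close>

lemma lambda_num_eq: "lambda_num n = pinj_num (n div 2) (n - n div 2)"
  by (simp add: lambda_num_def pinj_num_eq_sum atLeast0AtMost)

text \<open>Moving a point from the larger side to the smaller one narrows the gap by two and
  strictly increases the count while the gap is at least two. The process stops at the balanced
  split, so equality occurs only there.\<close>

lemma pinj_num_le_lambda_num_aux:
  assumes "a \<le> b"
  shows "pinj_num a b \<le> lambda_num (a + b) \<and>
    (pinj_num a b = lambda_num (a + b) \<longrightarrow> a = (a + b) div 2)"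
  using assms
proof (induction "b - a" arbitrary: a b rule: less_induct)
  case less
  show ?case
  proof (cases "b \<le> Suc a")
    case True
    then have "b = a \<or> b = Suc a" using less.prems by auto
    then have "(a + b) div 2 = a \<and> a + b - (a + b) div 2 = b" by auto
    then show ?thesis by (simp add: lambda_num_eq)
  next
    case False
    then obtain c where b: "b = Suc c" and c: "a < c" by (cases b) auto
    have "pinj_num (Suc a) c \<le> lambda_num (Suc a + c)"
      using less.hyps[of c "Suc a"] c b by auto
    with pinj_num_shift_less[OF c] show ?thesis by (simp add: b)
  qed
qed

lemma pinj_num_le_lambda_num: "pinj_num a b \<le> lambda_num (a + b)"
  using pinj_num_le_lambda_num_aux[of a b] pinj_num_le_lambda_num_aux[of b a]
  by (cases "a \<le> b") (auto simp: pinj_num_commute[of a b] add.commute)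

lemma pinj_num_eq_lambda_numD:
  assumes "pinj_num a b = lambda_num (a + b)"
  shows "a = (a + b) div 2 \<or> b = (a + b) div 2"
  using pinj_num_le_lambda_num_aux[of a b] pinj_num_le_lambda_num_aux[of b a] assms
  by (cases "a \<le> b") (auto simp: pinj_num_commute[of a b] add.commute)

section \<open>Recurrence, small values and growth of \<open>lambda_num\<close>\<close>

lemma lambda_num_0 [simp]: "lambda_num 0 = 1"
  and lambda_num_1 [simp]: "lambda_num (Suc 0) = 1"
  by (simp_all add: lambda_num_eq)

text \<open>One step of the recursion for \<open>pinj_num\<close> at the balanced split of
  \<open>n + 2\<close> leaves balanced splits of \<open>n + 1\<close> and \<open>n\<close>; for even
  \<open>n\<close> the former appears with its sides exchanged.\<close>

lemma lambda_num_rec: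
  "lambda_num (Suc (Suc n)) = lambda_num (Suc n) + Suc (n div 2) * lambda_num n"
proof (cases "even n")
  case True
  then obtain m where n: "n = 2 * m" by (elim evenE)
  then show ?thesis by (simp add: lambda_num_eq pinj_num_commute[of m "Suc m"])
next
  case False
  then obtain m where n: "n = 2 * m + 1" by (elim oddE)
  have "Suc (Suc (Suc (2 * m))) - Suc m = Suc (Suc m)" "Suc (2 * m) - m = Suc m"
    "Suc (Suc (2 * m)) - Suc m = Suc m" by auto
  then show ?thesis using pinj_num.simps(3)[of m "Suc m"]
    by (simp add: lambda_num_eq n del: pinj_num.simps)
qed

lemma lambda_num_small:
  "lambda_num 2 = 2" "lambda_num 3 = 3" "lambda_num 4 = 7" "lambda_num 5 = 13"
  "lambda_num 6 = 34" "lambda_num 7 = 73" "lambda_num 8 = 209" "lambda_num 9 = 501"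
  "lambda_num 10 = 1546"
proof -
  have rec: "lambda_num (k + 2) = lambda_num (k + 1) + (k div 2 + 1) * lambda_num k" for k
    by (simp add: lambda_num_rec)
  show l2: "lambda_num 2 = 2" using rec[of 0] by (simp add: numeral_2_eq_2)
  show l3: "lambda_num 3 = 3" using rec[of 1] l2 by (simp add: numeral_eq_Suc)
  show l4: "lambda_num 4 = 7" using rec[of 2] l2 l3 by simp
  show l5: "lambda_num 5 = 13" using rec[of 3] l3 l4 by simp
  show l6: "lambda_num 6 = 34" using rec[of 4] l4 l5 by simp
  show l7: "lambda_num 7 = 73" using rec[of 5] l5 l6 by simp
  show l8: "lambda_num 8 = 209" using rec[of 6] l6 l7 by simp
  show l9: "lambda_num 9 = 501" using rec[of 7] l7 l8 by simp
  show "lambda_num 10 = 1546" using rec[of 8] l8 l9 by simp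
qed

text \<open>The two inequalities carry each other through the induction: by
  \<open>lambda_num_rec\<close> the second one at \<open>n\<close> is the first one at
  \<open>Suc n\<close>, and the first one at \<open>n\<close> is what bounds the term
  \<open>Suc h * lambda_num n\<close> in the second one at \<open>Suc n\<close>.\<close>

lemma lambda_num_growth:
  assumes "8 \<le> n"
  shows "2 * lambda_num n + 2 \<le> lambda_num (Suc n) \<and>
    lambda_num (Suc n) + 2 \<le> Suc (n div 2) * lambda_num n"
  using assms
proof (induction n rule: dec_induct)
  case base
  then show ?case by (simp add: lambda_num_small)
next
  case (step n)
  define h where "h = n div 2"
  have h: "4 \<le> h" using step by (simp add: h_def)
  have rec: "lambda_num (Suc (Suc n)) = lambda_num (Suc n) + Suc h * lambda_num n"
    by (simp add: lambda_num_rec h_def)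
  \<comment> \<open>Naming the nonlinear product leaves a linear problem for
    \<open>presburger\<close>.\<close>
  define P where "P = h * lambda_num (Suc n)"
  have "Suc h * (2 * lambda_num n + 2) \<le> Suc h * lambda_num (Suc n)"
    using step by (intro mult_left_mono) auto
  then have "2 * lambda_num (Suc (Suc n)) + 2 * Suc h \<le> 3 * lambda_num (Suc n) + P"
    by (simp add: rec P_def algebra_simps)
  moreover have "lambda_num (Suc n) \<le> P"
    using h by (simp add: P_def)
  ultimately have "lambda_num (Suc (Suc n)) + 2 \<le> lambda_num (Suc n) + P"
    using h by presburger
  then have "lambda_num (Suc (Suc n)) + 2 \<le> Suc h * lambda_num (Suc n)"
    by (simp add: P_def)
  also have "\<dots> \<le> Suc (Suc n div 2) * lambda_num (Suc n)"
    unfolding h_def by (intro mult_right_mono) (auto intro: div_le_mono)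
  finally show ?case using step by (simp add: rec h_def)
qed

lemmas lambda_num_double = lambda_num_growth[THEN conjunct1]

lemma lambda_num_gt_power:
  assumes "10 \<le> n"
  shows "2 ^ n < lambda_num n + 1"
  using assms
proof (induction n rule: dec_induct)
  case base
  then show ?case by (simp add: lambda_num_small)
next
  case (step n)
  then show ?case using lambda_num_double[of n] by auto
qed

text \<open>For \<open>n = 1\<close> both sides are 2, hence the lower limit on
  \<open>n\<close>.\<close>

lemma lambda_num_lt_power:
  assumes "2 \<le> n" "n < 10"
  shows "lambda_num n + 1 < 2 ^ n"
proof -
  have "n \<in> {2,3,4,5,6,7,8,9}" using assms by auto
  then show ?thesis by (auto simp: lambda_num_small)
qed

text \<open>Induction in steps of two along \<open>lambda_num_rec\<close>: the coefficient
  \<open>Suc (c div 2)\<close> produced by \<open>b\<close> is at most the coefficient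
  \<open>Suc ((a + c) div 2)\<close> produced by \<open>a + b\<close>.\<close>

lemma lambda_num_mult_less:
  assumes a: "10 \<le> a" and "1 \<le> b"
  shows "(lambda_num a + 1) * (lambda_num b + 1) < lambda_num (a + b) + 1"
  using \<open>1 \<le> b\<close>
proof (induction b rule: less_induct)
  case (less b)
  consider "b = 1" | "b = 2" | c where "b = Suc (Suc c)" "1 \<le> c"
    using less.prems that(3)[of "b - 2"] by linarith
  then show ?case
  proof cases
    case 1
    then show ?thesis using lambda_num_double[of a] a by simp
  next
    case 2
    then show ?thesis using lambda_num_double[of a] lambda_num_double[of "Suc a"] a
      by (simp add: lambda_num_small)
  next
    case 3
    let ?A = "lambda_num a" and ?k = "Suc (c div 2)" and ?l = "Suc ((a + c) div 2)"
    have "(?A + 1) * (lambda_num (Suc c) + 1) < lambda_num (a + Suc c) + 1"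
      using less.IH[of "Suc c"] 3 by simp
    moreover have "(?A + 1) * (lambda_num c + 1) < lambda_num (a + c) + 1"
      using less.IH[of c] 3 by simp
    then have "(?A + 1) * lambda_num c \<le> lambda_num (a + c)"
      by (simp add: algebra_simps)
    then have "?k * ((?A + 1) * lambda_num c) \<le> ?l * lambda_num (a + c)"
      by (intro mult_mono) (auto intro: div_le_mono)
    ultimately show ?thesis
      by (simp add: 3 lambda_num_rec algebra_simps)
  qed
qed

section \<open>The bound and its behaviour on products\<close>

text \<open>For \<open>n\<close> at least 1 this is the larger of \<open>2 ^ n\<close> and
  \<open>lambda_num n + 1\<close>.\<close>

definition comm_bound :: "nat \<Rightarrow> nat" where
  "comm_bound n = (if n < 10 then 2 ^ n else lambda_num n + 1)"

lemma comm_bound_pos [simp]: "0 < comm_bound n"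
  by (simp add: comm_bound_def)

lemma lambda_num_power_less:
  assumes "10 \<le> a" "1 \<le> b"
  shows "(lambda_num a + 1) * 2 ^ b < lambda_num (a + b) + 1"
  using \<open>1 \<le> b\<close>
proof (induction b rule: dec_induct)
  case base
  then show ?case using lambda_num_double[of a] assms(1) by simp
next
  case (step b)
  then show ?case using lambda_num_double[of "a + b"] assms(1) by (simp add: algebra_simps)
qed

text \<open>If one summand is at least 10, the growth of \<open>lambda_num\<close> wins against
  either form of the other factor. If both are smaller, the product is \<open>2 ^ (a + b)\<close>,
  already below \<open>lambda_num (a + b) + 1\<close>.\<close>

lemma comm_bound_mult_less:
  assumes "1 \<le> a" "1 \<le> b" "10 \<le> a + b"
  shows "comm_bound a * comm_bound b < comm_bound (a + b)"
proof -
  consider "10 \<le> a" | "10 \<le> b" | "a < 10" "b < 10" by linarith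
  then show ?thesis
  proof cases
    case 1
    then show ?thesis
      using lambda_num_power_less[of a b] lambda_num_mult_less[of a b] assms
      by (auto simp: comm_bound_def)
  next
    case 2
    then show ?thesis
      using lambda_num_power_less[of b a] lambda_num_mult_less[of b a] assms
      by (auto simp: comm_bound_def ac_simps)
  next
    case 3
    then show ?thesis using lambda_num_gt_power[OF assms(3)] assms(3)
      by (simp add: comm_bound_def power_add)
  qed
qed

section \<open>Sets of partial injections and their cardinality\<close>

text \<open>Free of an ambient set, so that it covers the carrier of \<open>sym_inv X\<close>, the
  null semigroups and the restrictions to \<open>A\<close> alike.\<close>

definition partial_injections :: "'a set \<Rightarrow> 'b set \<Rightarrow> ('a \<rightharpoonup> 'b) set" where
  "partial_injections K L = {\<alpha>. dom \<alpha> \<subseteq> K \<and> ran \<alpha> \<subseteq> L \<and> inj_on \<alpha> (dom \<alpha>)}"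

lemma partial_injectionsI:
  assumes "\<And>x y. \<alpha> x = Some y \<Longrightarrow> x \<in> K \<and> y \<in> L"
    and "\<And>x x' y. \<alpha> x = Some y \<Longrightarrow> \<alpha> x' = Some y \<Longrightarrow> x = x'"
  shows "\<alpha> \<in> partial_injections K L"
  using assms by (auto simp: partial_injections_def ran_def inj_on_def)

lemma partial_injections_SomeD:
  assumes "\<alpha> \<in> partial_injections K L" "\<alpha> x = Some y"
  shows "x \<in> K" "y \<in> L"
  using assms by (auto simp: partial_injections_def ran_def)

lemma partial_injections_injD:
  assumes "\<alpha> \<in> partial_injections K L" "\<alpha> x = Some y" "\<alpha> x' = Some y"
  shows "x = x'"
  using assms by (auto simp: partial_injections_def inj_on_def dom_def)

lemma carrier_sym_inv: "carrier (sym_inv X) = partial_injections X X"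
  by (simp add: sym_inv_def partial_injections_def)

lemma mult_sym_inv [simp]: "\<alpha> \<otimes>\<^bsub>sym_inv X\<^esub> \<beta> = \<beta> \<circ>\<^sub>m \<alpha>"
  by (simp add: sym_inv_def)

lemma one_sym_inv [simp]: "\<one>\<^bsub>sym_inv X\<^esub> = Some |` X"
  by (simp add: sym_inv_def)

lemma finite_partial_injections:
  assumes "finite K" "finite L"
  shows "finite (partial_injections K L)"
proof (rule finite_subset)
  show "partial_injections K L \<subseteq> (\<Union>D\<in>Pow K. {\<alpha>. dom \<alpha> = D \<and> ran \<alpha> \<subseteq> L})"
    by (auto simp: partial_injections_def)
  show "finite (\<Union>D\<in>Pow K. {\<alpha>. dom \<alpha> = D \<and> ran \<alpha> \<subseteq> L})"
    using assms by (auto intro: finite_set_of_finite_maps finite_subset)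
qed

lemma partial_injections_empty_right: "partial_injections K {} = {Map.empty}"
proof -
  have "\<alpha> = Map.empty" if "ran \<alpha> = {}" for \<alpha> :: "'a \<rightharpoonup> 'b"
    using that by (intro ext) (metis ranI equals0D not_None_eq)
  then show ?thesis by (auto simp: partial_injections_def)
qed

text \<open>The point \<open>y\<close> is either missed or has a unique preimage \<open>x\<close>;
  deleting the pair leaves a partial injection on \<open>K - {x}\<close>.\<close>

lemma partial_injections_insert_right:
  assumes "y \<notin> L"
  shows "partial_injections K (insert y L) =
    partial_injections K L \<union> (\<Union>x\<in>K. (\<lambda>\<alpha>. \<alpha>(x \<mapsto> y)) ` partial_injections (K - {x}) L)"
    (is "?l = ?r1 \<union> ?r2")
proof
  show "?l \<subseteq> ?r1 \<union> ?r2"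
  proof
    fix \<alpha> assume \<alpha>: "\<alpha> \<in> ?l"
    show "\<alpha> \<in> ?r1 \<union> ?r2"
    proof (cases "\<exists>x. \<alpha> x = Some y")
      case True
      then obtain x where x: "\<alpha> x = Some y" by blast
      have "\<alpha>(x := None) \<in> partial_injections (K - {x}) L"
        using \<alpha> x
        by (intro partial_injectionsI)
          (auto split: if_splits dest: partial_injections_SomeD partial_injections_injD)
      moreover have "\<alpha> = (\<alpha>(x := None))(x \<mapsto> y)" using x by auto
      moreover have "x \<in> K" using \<alpha> x by (rule partial_injections_SomeD)
      ultimately show ?thesis by blast
    next
      case False
      then have "\<alpha> \<in> ?r1"
        using \<alpha>
        by (intro partial_injectionsI)
          (auto dest: partial_injections_SomeD partial_injections_injD)
      then show ?thesis by blast
    qed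
  qed
  have "?r1 \<subseteq> ?l" by (auto simp: partial_injections_def)
  moreover have "\<alpha>(x \<mapsto> y) \<in> ?l" if "x \<in> K" "\<alpha> \<in> partial_injections (K - {x}) L" for x \<alpha>
  proof (rule partial_injectionsI)
    show "u \<in> K \<and> v \<in> insert y L" if "(\<alpha>(x \<mapsto> y)) u = Some v" for u v
      using that \<open>x \<in> K\<close> partial_injections_SomeD[OF \<open>\<alpha> \<in> _\<close>, of u v]
      by (auto split: if_splits)
    show "u = u'" if "(\<alpha>(x \<mapsto> y)) u = Some v" "(\<alpha>(x \<mapsto> y)) u' = Some v" for u u' v
      using that assms partial_injections_SomeD(2)[OF \<open>\<alpha> \<in> _\<close>, of _ y]
        partial_injections_injD[OF \<open>\<alpha> \<in> _\<close>, of u v u']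
      by (auto split: if_splits)
  qed
  ultimately show "?r1 \<union> ?r2 \<subseteq> ?l" by blast
qed

lemma card_partial_injections:
  assumes "finite K" "finite L"
  shows "card (partial_injections K L) = pinj_num (card K) (card L)"
  using assms(2,1)
proof (induction L arbitrary: K rule: finite_induct)
  case empty
  then show ?case by (simp add: partial_injections_empty_right)
next
  case (insert y L)
  let ?f = "\<lambda>x \<alpha>. \<alpha>(x \<mapsto> y)"
  let ?P = "\<lambda>x. ?f x ` partial_injections (K - {x}) L"
  have card_P: "card (?P x) = pinj_num (card K - 1) (card L)" if "x \<in> K" for x
  proof -
    have "inj_on (?f x) (partial_injections (K - {x}) L)"
    proof (rule inj_onI)
      fix \<alpha> \<beta>
      assume *: "\<alpha> \<in> partial_injections (K - {x}) L" "\<beta> \<in> partial_injections (K - {x}) L"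
        "?f x \<alpha> = ?f x \<beta>"
      \<comment> \<open>Resetting \<open>x\<close> to \<open>None\<close> therefore undoes the
        update.\<close>
      have "\<alpha> x = None" "\<beta> x = None" using * by (auto simp: partial_injections_def)
      with *(3) show "\<alpha> = \<beta>" by (metis fun_upd_triv fun_upd_upd)
    qed
    with that show ?thesis using insert.IH[of "K - {x}"] insert.prems by (simp add: card_image)
  qed
  have "card (\<Union>x\<in>K. ?P x) = (\<Sum>x\<in>K. card (?P x))"
  proof (rule card_UN_disjoint)
    show "\<forall>i\<in>K. \<forall>j\<in>K. i \<noteq> j \<longrightarrow> ?P i \<inter> ?P j = {}"
    proof (intro ballI impI equals0I)
      fix i j \<gamma> assume ij: "i \<in> K" "j \<in> K" "i \<noteq> j" and \<gamma>: "\<gamma> \<in> ?P i \<inter> ?P j"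
      have "\<gamma> \<in> partial_injections K (insert y L)"
        using partial_injections_insert_right[OF insert.hyps(2), of K] ij \<gamma> by blast
      moreover have "\<gamma> k = Some y" if "\<gamma> \<in> ?P k" for k using that by auto
      then have "\<gamma> i = Some y" "\<gamma> j = Some y" using \<gamma> by blast+
      ultimately show False using ij by (blast dest: partial_injections_injD)
    qed
  qed (use insert in \<open>auto intro: finite_partial_injections\<close>)
  also have "\<dots> = card K * pinj_num (card K - 1) (card L)" using card_P by simp
  finally have UN: "card (\<Union>x\<in>K. ?P x) = card K * pinj_num (card K - 1) (card L)" .
  have "partial_injections K L \<inter> (\<Union>x\<in>K. ?P x) = {}"
  proof (intro equals0I)
    fix \<gamma> assume "\<gamma> \<in> partial_injections K L \<inter> (\<Union>x\<in>K. ?P x)"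
    then obtain x \<alpha> where "\<gamma> \<in> partial_injections K L" "\<gamma> = \<alpha>(x \<mapsto> y)" by blast
    then have "\<gamma> \<in> partial_injections K L" "\<gamma> x = Some y" by simp_all
    then show False using insert.hyps(2) by (blast dest: partial_injections_SomeD)
  qed
  then have "card (partial_injections K (insert y L)) =
      card (partial_injections K L) + card (\<Union>x\<in>K. ?P x)"
    unfolding partial_injections_insert_right[OF insert.hyps(2)] using insert
    by (intro card_Un_disjoint) (auto intro: finite_partial_injections)
  then show ?case using UN insert by (simp add: pinj_num_Suc_right)
qed

section \<open>Commutative subsemigroups without proper invariant sets\<close>

lemma comm_subsemigroups_iff:
  "S \<in> comm_subsemigroups (sym_inv X) \<longleftrightarrow>
     S \<noteq> {} \<and> S \<subseteq> partial_injections X X \<and>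
     (\<forall>\<alpha>\<in>S. \<forall>\<beta>\<in>S. \<beta> \<circ>\<^sub>m \<alpha> \<in> S) \<and> (\<forall>\<alpha>\<in>S. \<forall>\<beta>\<in>S. \<beta> \<circ>\<^sub>m \<alpha> = \<alpha> \<circ>\<^sub>m \<beta>)"
  by (simp add: comm_subsemigroups_def carrier_sym_inv)

text \<open>Commutativity as a square: a two-step path from \<open>x\<close> to \<open>z\<close> can
  be walked in the other order. In particular \<open>\<beta>\<close> must be defined at
  \<open>x\<close>.\<close>

lemma commD:
  assumes "\<forall>\<alpha>\<in>S. \<forall>\<beta>\<in>S. \<beta> \<circ>\<^sub>m \<alpha> = \<alpha> \<circ>\<^sub>m \<beta>" "\<alpha> \<in> S" "\<beta> \<in> S"
    "\<alpha> x = Some y" "\<beta> y = Some z"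
  obtains u where "\<beta> x = Some u" "\<alpha> u = Some z"
proof -
  have "(\<alpha> \<circ>\<^sub>m \<beta>) x = Some z" using assms by (metis map_comp_simps(2))
  then show ?thesis using that by (auto simp: map_comp_Some_iff)
qed

text \<open>The equivalence, instead of an implication, lets the property pass from \<open>Y\<close>
  to \<open>X - Y\<close> for subsemigroups of \<open>sym_inv X\<close>.\<close>

definition invariant_set :: "('a \<rightharpoonup> 'a) set \<Rightarrow> 'a set \<Rightarrow> bool" where
  "invariant_set S Y \<longleftrightarrow> (\<forall>\<alpha>\<in>S. \<forall>x y. \<alpha> x = Some y \<longrightarrow> (x \<in> Y \<longleftrightarrow> y \<in> Y))"

lemma indecomposable_embedding:
  assumes "finite X" and S: "S \<in> comm_subsemigroups (sym_inv X)"
    and one: "Some |` X \<in> S"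
    and indec: "\<And>Y. Y \<subseteq> X \<Longrightarrow> invariant_set S Y \<Longrightarrow> Y = {} \<or> Y = X"
  obtains A where "A \<subseteq> X"
    and "\<And>\<alpha>. \<alpha> \<in> S - {Some |` X} \<Longrightarrow> \<alpha> |` A \<in> partial_injections A (X - A)"
    and "inj_on (\<lambda>\<alpha>. \<alpha> |` A) S"
proof -
  have sub: "S \<subseteq> partial_injections X X"
    and comm: "\<forall>\<alpha>\<in>S. \<forall>\<beta>\<in>S. \<beta> \<circ>\<^sub>m \<alpha> = \<alpha> \<circ>\<^sub>m \<beta>"
    and closed: "\<And>\<alpha> \<beta>. \<alpha> \<in> S \<Longrightarrow> \<beta> \<in> S \<Longrightarrow> \<beta> \<circ>\<^sub>m \<alpha> \<in> S"
    using S by (auto simp: comm_subsemigroups_iff)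
  have inX: "x \<in> X" "y \<in> X" if "\<alpha> \<in> S" "\<alpha> x = Some y" for \<alpha> x y
    using sub that by (auto dest: partial_injections_SomeD)
  have inj: "x = x'" if "\<alpha> \<in> S" "\<alpha> x = Some y" "\<alpha> x' = Some y" for \<alpha> x x' y
    using sub that by (auto dest: partial_injections_injD)
  have no_fix: "\<beta> x \<noteq> Some x" if \<beta>: "\<beta> \<in> S - {Some |` X}" for \<beta> x
  proof
    assume x: "\<beta> x = Some x"
    let ?F = "{x \<in> X. \<beta> x = Some x}"
    have "invariant_set S ?F"
      unfolding invariant_set_def
    proof (intro ballI allI impI iffI)
      fix \<alpha> y z assume \<alpha>: "\<alpha> \<in> S" and yz: "\<alpha> y = Some z"
      {
        assume "y \<in> ?F"
        then obtain u where "\<alpha> y = Some u" "\<beta> u = Some z"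
          using commD[OF comm _ \<alpha>, of \<beta> y y z] \<beta> yz by auto
        then show "z \<in> ?F" using yz inX \<alpha> by auto
      next
        assume "z \<in> ?F"
        then obtain u where "\<beta> y = Some u" "\<alpha> u = Some z"
          \<comment> \<open>Both \<open>u\<close> and \<open>y\<close> are sent to \<open>z\<close>
            by \<open>\<alpha>\<close>, so injectivity gives \<open>u = y\<close>.\<close>
          using commD[OF comm \<alpha>, of \<beta> y z z] \<beta> yz by auto
        then show "y \<in> ?F" using yz inX \<alpha> inj by auto
      }
    qed
    then have "?F = {} \<or> ?F = X" by (intro indec) auto
    moreover have "x \<in> ?F" using x \<beta> inX by auto
    ultimately have "\<And>y. y \<in> X \<Longrightarrow> \<beta> y = Some y" by blast
    then have "\<beta> = Some |` X"
      using inX(1)[of \<beta>] \<beta> by (intro ext) (metis DiffD1 not_None_eq restrict_in restrict_out)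
    with \<beta> show False by simp
  qed
  \<comment> \<open>Every point of \<open>X\<close> is reached from \<open>A\<close> in one step,
    which suffices because \<open>S\<close> is closed; \<open>X\<close> qualifies through the
    identity.\<close>
  let ?gen = "\<lambda>A. \<forall>y\<in>X. \<exists>x\<in>A. \<exists>\<beta>\<in>S. \<beta> x = Some y"
  have "?gen X" using one by (metis restrict_in)
  then have "{A \<in> Pow X. ?gen A} \<noteq> {}" by blast
  then obtain A where "A \<in> {A \<in> Pow X. ?gen A}"
    and "\<forall>B\<in>{A \<in> Pow X. ?gen A}. B \<subseteq> A \<longrightarrow> A = B"
    using finite_has_minimal[of "{A \<in> Pow X. ?gen A}"] \<open>finite X\<close> by auto
  then have A: "A \<subseteq> X" "?gen A" and minA: "\<And>B. B \<subseteq> A \<Longrightarrow> ?gen B \<Longrightarrow> B = A"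
    by (blast, blast, blast)
  show ?thesis
  proof
    show "A \<subseteq> X" by fact
  next
    fix \<alpha> assume \<alpha>: "\<alpha> \<in> S - {Some |` X}"
    have "y \<notin> A" if x: "x \<in> A" "\<alpha> x = Some y" for x y
    proof
      assume y: "y \<in> A"
      have "x \<noteq> y" using no_fix \<alpha> x by auto
      \<comment> \<open>Whatever \<open>y\<close> reaches is reached from \<open>x\<close> through
        \<open>\<alpha>\<close>, so \<open>y\<close> is redundant, against minimality.\<close>
      have "?gen (A - {y})"
      proof
        fix z assume "z \<in> X"
        then obtain w \<beta> where w: "w \<in> A" "\<beta> \<in> S" "\<beta> w = Some z" using A by blast
        show "\<exists>x\<in>A - {y}. \<exists>\<beta>\<in>S. \<beta> x = Some z"
        proof (cases "w = y")
          case True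
          then have "(\<beta> \<circ>\<^sub>m \<alpha>) x = Some z" using w x by simp
          then show ?thesis using closed[of \<alpha> \<beta>] w \<alpha> x \<open>x \<noteq> y\<close> by blast
        qed (use w in blast)
      qed
      then have "A - {y} = A" by (intro minA) auto
      with y show False by blast
    qed
    then show "\<alpha> |` A \<in> partial_injections A (X - A)"
      using \<alpha> inX inj
      by (intro partial_injectionsI) (auto simp: restrict_map_def split: if_splits)
  next
    have "\<beta> y = Some z" if \<alpha>\<beta>: "\<alpha> \<in> S" "\<beta> \<in> S" "\<alpha> |` A = \<beta> |` A" and yz: "\<alpha> y = Some z" for \<alpha> \<beta> y z
    proof -
      \<comment> \<open>Commuting with \<open>\<gamma>\<close> expresses the value at
        \<open>y\<close> through the value at \<open>x\<close>, where \<open>\<alpha>\<close> and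
        \<open>\<beta>\<close> agree.\<close>
      obtain x \<gamma> where x: "x \<in> A" "\<gamma> \<in> S" "\<gamma> x = Some y" using A inX \<alpha>\<beta> yz by blast
      obtain u where u: "\<alpha> x = Some u" "\<gamma> u = Some z"
        using commD[OF comm x(2) \<alpha>\<beta>(1) x(3) yz] by blast
      have "\<beta> x = Some u" using \<alpha>\<beta> u x by (metis restrict_in)
      then show ?thesis using commD[OF comm \<alpha>\<beta>(2) x(2) _ u(2)] x(3) by (metis option.inject)
    qed
    then show "inj_on (\<lambda>\<alpha>. \<alpha> |` A) S"
      by (intro inj_onI ext) (metis not_None_eq)
  qed
qed

text \<open>
  If \<open>w\<delta> = z\<close> with \<open>w \<notin> A\<close>, choose \<open>x \<noteq> x'\<close> in \<open>A\<close> and \<open>\<epsilon>\<close> whose restriction to \<open>A\<close> is \<open>x \<mapsto> w\<close>. Then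
  \<open>u = x\<delta>\<close> satisfies \<open>u\<epsilon> = z\<close>, so commuting \<open>\<epsilon>\<close> with an \<open>\<alpha>\<close> that maps \<open>x'\<close> to \<open>u\<close> makes \<open>x'\<epsilon>\<close>
  defined, a contradiction.
\<close>

lemma indecomposable_extremal:
  assumes S: "S \<in> comm_subsemigroups (sym_inv X)"
    and A: "A \<subseteq> X" "2 \<le> card A"
    and sub: "\<And>\<alpha>. \<alpha> \<in> S - {Some |` X} \<Longrightarrow> \<alpha> |` A \<in> partial_injections A (X - A)"
    and onto: "partial_injections A (X - A) \<subseteq> (\<lambda>\<alpha>. \<alpha> |` A) ` (S - {Some |` X})"
  shows "S - {Some |` X} = partial_injections A (X - A)"
proof -
  have comm: "\<forall>\<alpha>\<in>S. \<forall>\<beta>\<in>S. \<beta> \<circ>\<^sub>m \<alpha> = \<alpha> \<circ>\<^sub>m \<beta>" and SX: "S \<subseteq> partial_injections X X"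
    using S by (auto simp: comm_subsemigroups_iff)
  have single: "\<exists>\<epsilon>\<in>S. \<epsilon> x = Some w \<and> (\<forall>x'\<in>A. x' \<noteq> x \<longrightarrow> \<epsilon> x' = None)"
    if "x \<in> A" "w \<in> X - A" for x w
  proof -
    have "[x \<mapsto> w] \<in> partial_injections A (X - A)"
      using that by (intro partial_injectionsI) (auto split: if_splits)
    then obtain \<epsilon> where "\<epsilon> \<in> S" "[x \<mapsto> w] = \<epsilon> |` A" using onto by blast
    then show ?thesis using that by (metis fun_upd_other fun_upd_same restrict_in)
  qed
  have dom: "w \<in> A" if \<delta>: "\<delta> \<in> S - {Some |` X}" and wz: "\<delta> w = Some z" for \<delta> w z
  proof (rule ccontr)
    assume "w \<notin> A"
    with SX \<delta> wz have w: "w \<in> X - A" by (auto dest: partial_injections_SomeD)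
    obtain x where x: "x \<in> A" using A by fastforce
    obtain x' where x': "x' \<in> A" "x' \<noteq> x"
      using A(2) card_le_Suc0_iff_eq[of A] x
      by (metis One_nat_def Suc_1 card.infinite not_less_eq_eq zero_le)
    obtain \<epsilon> where \<epsilon>: "\<epsilon> \<in> S" "\<epsilon> x = Some w" "\<forall>x'\<in>A. x' \<noteq> x \<longrightarrow> \<epsilon> x' = None"
      using single[OF x w] by blast
    obtain u where u: "\<delta> x = Some u" "\<epsilon> u = Some z"
      using commD[OF comm \<epsilon>(1) _ \<epsilon>(2), of \<delta> z] \<delta> wz by blast
    have "u \<in> X - A"
      using sub[OF \<delta>] u x partial_injections_SomeD(2)[of "\<delta> |` A" A "X - A" x u] by simp
    then obtain \<alpha> where \<alpha>: "\<alpha> \<in> S" "\<alpha> x' = Some u" using single[OF x'(1)] by blast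
    obtain v where "\<epsilon> x' = Some v"
      using commD[OF comm \<alpha>(1) \<epsilon>(1) \<alpha>(2) u(2)] by blast
    then show False using \<epsilon>(3) x' by simp
  qed
  have restrict: "\<alpha> |` A = \<alpha>" if "\<alpha> \<in> S - {Some |` X}" for \<alpha>
  proof
    fix x show "(\<alpha> |` A) x = \<alpha> x"
      using dom[OF that, of x] by (cases "\<alpha> x") (auto simp: restrict_map_def)
  qed
  show ?thesis
  proof
    show "S - {Some |` X} \<subseteq> partial_injections A (X - A)" using sub restrict by fastforce
    show "partial_injections A (X - A) \<subseteq> S - {Some |` X}" using onto restrict by fastforce
  qed
qed

lemma restrict_map_Some_iff: "(\<alpha> |` Y) x = Some y \<longleftrightarrow> x \<in> Y \<and> \<alpha> x = Some y"
  by (auto simp: restrict_map_def)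

section \<open>The semilattice of idempotents\<close>

text \<open>An idempotent fixes every point \<open>y\<close> of its image, so if it also sends
  \<open>x\<close> to \<open>y\<close>, injectivity gives \<open>x = y\<close>.\<close>

lemma idempotents_sym_inv: "idempotents (sym_inv X) = (\<lambda>Y. Some |` Y) ` Pow X"
proof
  show "idempotents (sym_inv X) \<subseteq> (\<lambda>Y. Some |` Y) ` Pow X"
  proof
    fix \<alpha> assume "\<alpha> \<in> idempotents (sym_inv X)"
    then have \<alpha>: "\<alpha> \<in> partial_injections X X" "\<alpha> \<circ>\<^sub>m \<alpha> = \<alpha>"
      by (auto simp: idempotents_def carrier_sym_inv)
    have "y = x" if xy: "\<alpha> x = Some y" for x y
    proof -
      have "\<alpha> y = Some y" using \<alpha>(2) xy by (metis map_comp_simps(2))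
      then show ?thesis using \<alpha>(1) xy by (blast dest: partial_injections_injD)
    qed
    then have "\<alpha> = Some |` dom \<alpha>"
      by (intro ext) (auto simp: restrict_map_def dom_def)
    moreover have "dom \<alpha> \<subseteq> X" using \<alpha>(1) by (simp add: partial_injections_def)
    ultimately show "\<alpha> \<in> (\<lambda>Y. Some |` Y) ` Pow X" by blast
  qed
  show "(\<lambda>Y. Some |` Y) ` Pow X \<subseteq> idempotents (sym_inv X)"
    by (auto simp: idempotents_def carrier_sym_inv map_comp_def restrict_map_def fun_eq_iff
        intro!: partial_injectionsI split: if_splits)
qed

lemma card_idempotents_sym_inv:
  assumes "finite X"
  shows "card (idempotents (sym_inv X)) = 2 ^ card X"
proof -
  have "inj_on (\<lambda>Y. Some |` Y) (Pow X)"
    by (rule inj_on_inverseI[of _ dom]) auto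
  then show ?thesis
    by (simp add: idempotents_sym_inv card_image card_Pow assms)
qed

lemma idempotents_in_comm_subsemigroups:
  "idempotents (sym_inv X) \<in> comm_subsemigroups (sym_inv X)"
proof -
  have comp: "(Some |` Y) \<circ>\<^sub>m (Some |` Z) = Some |` (Y \<inter> Z)" for Y Z :: "'a set"
    by (auto simp: map_comp_def restrict_map_def fun_eq_iff)
  have "idempotents (sym_inv X) \<subseteq> partial_injections X X"
    by (auto simp: idempotents_def carrier_sym_inv)
  then show ?thesis
    unfolding comm_subsemigroups_iff by (auto simp: idempotents_sym_inv comp Int_commute)
qed

section \<open>Null monoids: products, number and isomorphism\<close>

lemma partial_injections_mono:
  "K \<subseteq> K' \<Longrightarrow> L \<subseteq> L' \<Longrightarrow> partial_injections K L \<subseteq> partial_injections K' L'"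
  by (auto simp: partial_injections_def)

lemma empty_in_partial_injections [simp]: "Map.empty \<in> partial_injections K L"
  by (simp add: partial_injections_def)

lemma one_in_partial_injections [simp]: "Some |` X \<in> partial_injections X X"
  by (auto intro!: partial_injectionsI simp: restrict_map_Some_iff)

lemma one_map_comp:
  assumes "\<alpha> \<in> partial_injections X X"
  shows "(Some |` X) \<circ>\<^sub>m \<alpha> = \<alpha>" "\<alpha> \<circ>\<^sub>m (Some |` X) = \<alpha>"
proof -
  show "(Some |` X) \<circ>\<^sub>m \<alpha> = \<alpha>"
  proof
    fix x show "((Some |` X) \<circ>\<^sub>m \<alpha>) x = \<alpha> x"
      using partial_injections_SomeD[OF assms, of x] by (cases "\<alpha> x") auto
  qed
  show "\<alpha> \<circ>\<^sub>m (Some |` X) = \<alpha>"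
  proof
    fix x show "(\<alpha> \<circ>\<^sub>m (Some |` X)) x = \<alpha> x"
      using partial_injections_SomeD[OF assms, of x]
      by (cases "\<alpha> x") (auto simp: map_comp_def restrict_map_def)
  qed
qed

lemma insert_one_in_comm_subsemigroups:
  assumes "S \<in> comm_subsemigroups (sym_inv X)"
  shows "insert (Some |` X) S \<in> comm_subsemigroups (sym_inv X)"
  using assms unfolding comm_subsemigroups_iff
  by (auto simp: one_map_comp subset_iff)

lemma null_semigroup_eq:
  assumes "K \<subseteq> X" "L \<subseteq> X"
  shows "null_semigroup X K L = partial_injections K L"
  using assms by (auto simp: null_semigroup_def carrier_sym_inv partial_injections_def)

lemma null_map_comp:
  assumes "\<alpha> \<in> partial_injections K L" "\<beta> \<in> partial_injections K L" "K \<inter> L = {}"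
  shows "\<beta> \<circ>\<^sub>m \<alpha> = Map.empty"
proof
  fix x show "(\<beta> \<circ>\<^sub>m \<alpha>) x = None"
  proof (rule ccontr)
    assume "(\<beta> \<circ>\<^sub>m \<alpha>) x \<noteq> None"
    then obtain y z where "\<alpha> x = Some y" "\<beta> y = Some z" by (auto simp: map_comp_Some_iff)
    with assms show False by (blast dest: partial_injections_SomeD)
  qed
qed

lemma one_notin_partial_injections:
  assumes "K \<subset> X"
  shows "Some |` X \<notin> partial_injections K L"
  using assms by (auto simp: partial_injections_def)

lemma null_monoid_in_comm_subsemigroups:
  assumes "K \<subseteq> X" "L \<subseteq> X" "K \<inter> L = {}"
  shows "partial_injections K L \<union> {Some |` X} \<in> comm_subsemigroups (sym_inv X)"
proof -
  have "partial_injections K L \<in> comm_subsemigroups (sym_inv X)"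
    using partial_injections_mono[OF assms(1,2)] assms(3)
      empty_in_partial_injections[of K L]
    unfolding comm_subsemigroups_iff
    by (auto simp: null_map_comp simp del: empty_in_partial_injections)
  then show ?thesis using insert_one_in_comm_subsemigroups by fastforce
qed

text \<open>Since \<open>L\<close> is the complement of \<open>K\<close>, the family is indexed by
  \<open>K\<close> alone, ready for counting. The assumption on \<open>card X\<close> makes both
  blocks nonempty.\<close>

lemma balanced_null_monoids_eq:
  assumes "2 \<le> card X"
  shows "balanced_null_monoids X = (\<lambda>K. partial_injections K (X - K) \<union> {Some |` X}) `
    {K. K \<subseteq> X \<and> (card K = card X div 2 \<or> card K = card X - card X div 2)}"
    (is "?l = ?f ` ?K")
proof
  have fin: "finite X" using assms by (metis card.infinite not_numeral_le_zero)
  show "?l \<subseteq> ?f ` ?K"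
  proof
    fix M assume "M \<in> ?l"
    then obtain K L where M: "M = null_semigroup X K L \<union> {\<one>\<^bsub>sym_inv X\<^esub>}"
      and KL: "balanced_partition X K L"
      by (auto simp: balanced_null_monoids_def)
    then have "L = X - K" "K \<subseteq> X" "card K = card X div 2 \<or> card K = card X - card X div 2"
      by (auto simp: balanced_partition_def)
    then show "M \<in> ?f ` ?K" using M by (auto simp: null_semigroup_eq)
  qed
  show "?f ` ?K \<subseteq> ?l"
  proof
    fix M assume "M \<in> ?f ` ?K"
    then obtain K where K: "K \<in> ?K" "M = ?f K" by blast
    have card: "card (X - K) = card X - card K"
      using K fin by (auto intro!: card_Diff_subset intro: finite_subset)
    have "balanced_partition X K (X - K)"
      using K assms card unfolding balanced_partition_def by (auto simp: div_eq_0_iff)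
    moreover have "M = null_semigroup X K (X - K) \<union> {\<one>\<^bsub>sym_inv X\<^esub>}"
      using K by (auto simp: null_semigroup_eq)
    ultimately show "M \<in> ?l" unfolding balanced_null_monoids_def by blast
  qed
qed

lemma card_null_monoid:
  assumes "finite X" "K \<subset> X" "L \<subseteq> X"
  shows "card (partial_injections K L \<union> {Some |` X}) = pinj_num (card K) (card L) + 1"
proof -
  have "finite K" "finite L" using assms by (auto intro: finite_subset)
  then show ?thesis
    using one_notin_partial_injections[OF assms(2)]
    by (simp add: finite_partial_injections card_partial_injections)
qed

lemma card_balanced_null_monoids:
  assumes "2 \<le> card X"
  shows "card (balanced_null_monoids X) =
    (if even (card X) then 1 else 2) * (card X choose (card X div 2))"
proof -
  let ?n = "card X" and ?m = "card X div 2"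
  let ?f = "\<lambda>K. partial_injections K (X - K) \<union> {Some |` X}"
  let ?A = "\<lambda>k. {K. K \<subseteq> X \<and> card K = k}"
  have fin: "finite X" using assms by (metis card.infinite not_numeral_le_zero)
  have eq: "{K. K \<subseteq> X \<and> (card K = ?m \<or> card K = ?n - ?m)} = ?A ?m \<union> ?A (?n - ?m)"
    by (simp add: Collect_disj_eq conj_disj_distribL)
  have "inj_on ?f (?A ?m \<union> ?A (?n - ?m))"
  \<comment> \<open>\<open>K\<close> is recovered as the union of the domains of the non-identity
    elements.\<close>
  proof (rule inj_on_inverseI[of _ "\<lambda>M. \<Union>(dom ` (M - {Some |` X}))"])
    fix K assume K: "K \<in> ?A ?m \<union> ?A (?n - ?m)"
    have "card K = ?m \<or> card K = ?n - ?m" using K by blast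
    then have "card K < ?n" using assms by linarith
    with K have "K \<subset> X" by blast
    \<comment> \<open>A single target outside \<open>K\<close> shows that each point of
      \<open>K\<close> lies in the domain of some element.\<close>
    then obtain y where y: "y \<in> X - K" by blast
    have "K \<subseteq> \<Union>(dom ` partial_injections K (X - K))"
    proof
      fix x assume "x \<in> K"
      then have "[x \<mapsto> y] \<in> partial_injections K (X - K)"
        using y by (intro partial_injectionsI) (simp_all split: if_splits)
      then show "x \<in> \<Union>(dom ` partial_injections K (X - K))" by (rule UN_I) simp
    qed
    moreover have "\<Union>(dom ` partial_injections K (X - K)) \<subseteq> K"
      by (rule UN_least) (simp add: partial_injections_def)
    moreover have "?f K - {Some |` X} = partial_injections K (X - K)"
      using one_notin_partial_injections[OF \<open>K \<subset> X\<close>, of "X - K"] by simp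
    ultimately show "\<Union>(dom ` (?f K - {Some |` X})) = K"
      by (simp only: subset_antisym)
  qed
  then have "card (balanced_null_monoids X) = card (?A ?m \<union> ?A (?n - ?m))"
    unfolding balanced_null_monoids_eq[OF assms] eq by (rule card_image)
  also have "\<dots> = (if even ?n then 1 else 2) * (?n choose ?m)"
  \<comment> \<open>For even \<open>?n\<close> the two admissible sizes coincide; for odd
    \<open>?n\<close> they give disjoint families of equal size.\<close>
  proof (cases "even ?n")
    case True
    then have "?n - ?m = ?m" by presburger
    then show ?thesis using True n_subsets[OF fin, of ?m] by (simp only: Un_absorb if_True mult_1)
  next
    case False
    then have "?n - ?m \<noteq> ?m" by presburger
    then have "?A ?m \<inter> ?A (?n - ?m) = {}" by (auto simp only:)
    then have "card (?A ?m \<union> ?A (?n - ?m)) = card (?A ?m) + card (?A (?n - ?m))"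
      using fin by (intro card_Un_disjoint) simp_all
    also have "\<dots> = 2 * (?n choose ?m)"
      by (simp only: n_subsets[OF fin] binomial_symmetric[of ?m ?n, OF div_le_dividend, symmetric]
          mult_2)
    finally show ?thesis using False by simp
  qed
  finally show ?thesis .
qed

text \<open>All products of non-identity elements are zero, so any bijection that fixes zero and the
  identity is an isomorphism, and only the cardinalities matter.\<close>

lemma null_monoids_iso:
  assumes "finite X" "K \<subset> X" "L \<subseteq> X" "K \<inter> L = {}" "K' \<subset> X" "L' \<subseteq> X" "K' \<inter> L' = {}"
    and card: "card (partial_injections K L \<union> {Some |` X}) =
      card (partial_injections K' L' \<union> {Some |` X})"
  shows "iso_subsemigroups (sym_inv X) (partial_injections K L \<union> {Some |` X})
    (partial_injections K' L' \<union> {Some |` X})"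
proof -
  let ?P = "partial_injections K L" and ?Q = "partial_injections K' L'" and ?e = "Some |` X"
  have fin: "finite ?P" "finite ?Q"
    using assms by (auto intro!: finite_partial_injections intro: finite_subset)
  have e: "?e \<notin> ?P" "?e \<notin> ?Q" using assms by (simp_all add: one_notin_partial_injections)
  have "card ?P = card ?Q" using card fin e by simp
  then have "card (?P - {Map.empty}) = card (?Q - {Map.empty})" by simp
  then obtain g where g: "bij_betw g (?P - {Map.empty}) (?Q - {Map.empty})"
    using fin by (metis finite_Diff finite_same_card_bij)
  define h where "h \<alpha> = (if \<alpha> = ?e \<or> \<alpha> = Map.empty then \<alpha> else g \<alpha>)" for \<alpha>
  have "bij_betw h (?P - {Map.empty}) (?Q - {Map.empty})"
    using g by (rule bij_betw_cong[THEN iffD1, rotated]) (use e in \<open>auto simp: h_def\<close>)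
  moreover have "bij_betw h {Map.empty, ?e} {Map.empty, ?e}"
    by (auto simp: h_def bij_betw_def inj_on_def)
  ultimately have "bij_betw h ((?P - {Map.empty}) \<union> {Map.empty, ?e}) ((?Q - {Map.empty}) \<union> {Map.empty, ?e})"
    using e by (intro bij_betw_combine) auto
  moreover have "(?P - {Map.empty}) \<union> {Map.empty, ?e} = ?P \<union> {?e}"
    "(?Q - {Map.empty}) \<union> {Map.empty, ?e} = ?Q \<union> {?e}"
    by (simp_all add: insert_absorb insert_commute[of _ ?e])
  ultimately have bij: "bij_betw h (?P \<union> {?e}) (?Q \<union> {?e})" by simp
  have hP: "h \<alpha> \<in> ?Q" if "\<alpha> \<in> ?P" for \<alpha>
    using that e bij_betw_apply[OF g, of \<alpha>] by (auto simp: h_def)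
  have sub: "?P \<subseteq> partial_injections X X" "?Q \<subseteq> partial_injections X X"
    by (rule partial_injections_mono; use assms in blast)+
  have he: "h ?e = ?e" "h Map.empty = Map.empty" by (simp_all add: h_def)
  have "h (\<beta> \<circ>\<^sub>m \<alpha>) = h \<beta> \<circ>\<^sub>m h \<alpha>" if \<alpha>: "\<alpha> \<in> ?P \<union> {?e}" and \<beta>: "\<beta> \<in> ?P \<union> {?e}" for \<alpha> \<beta>
  proof -
    have hX: "h \<gamma> \<in> partial_injections X X" and X: "\<gamma> \<in> partial_injections X X"
      if "\<gamma> \<in> ?P \<union> {?e}" for \<gamma>
      using that hP[of \<gamma>] sub by (auto simp only: he Un_iff singleton_iff one_in_partial_injections)
    consider "\<alpha> = ?e" | "\<beta> = ?e" | "\<alpha> \<in> ?P" "\<beta> \<in> ?P" using \<alpha> \<beta> by blast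
    then show ?thesis
    proof cases
      case 3
      then have "\<beta> \<circ>\<^sub>m \<alpha> = Map.empty" "h \<beta> \<circ>\<^sub>m h \<alpha> = Map.empty"
        using null_map_comp[of \<alpha> K L \<beta>] null_map_comp[of "h \<alpha>" K' L' "h \<beta>"] hP assms by auto
      then show ?thesis by (simp add: he)
    qed (use \<alpha> \<beta> hX X in \<open>simp_all add: he one_map_comp\<close>)
  qed
  moreover have "h \<alpha> \<in> ?Q \<union> {?e}" if "\<alpha> \<in> ?P \<union> {?e}" for \<alpha>
    using that hP he by auto
  ultimately have "h \<in> iso (sym_inv X\<lparr>carrier := ?P \<union> {?e}\<rparr>) (sym_inv X\<lparr>carrier := ?Q \<union> {?e}\<rparr>)"
    using bij by (simp add: iso_def hom_def)
  then show ?thesis unfolding iso_subsemigroups_def is_iso_def by blast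
qed

section \<open>Upper bound and uniqueness of the extremal subsemigroups\<close>

lemma indecomposable_bound:
  assumes fin: "finite X" and S: "S \<in> comm_subsemigroups (sym_inv X)"
    and indec: "\<And>Y. Y \<subseteq> X \<Longrightarrow> invariant_set S Y \<Longrightarrow> Y = {} \<or> Y = X"
  shows "card S \<le> lambda_num (card X) + 1"
    and "10 \<le> card X \<Longrightarrow> card S = lambda_num (card X) + 1 \<Longrightarrow> S \<in> balanced_null_monoids X"
proof -
  let ?e = "Some |` X"
  \<comment> \<open>\<open>indecomposable_embedding\<close> wants the identity inside; adjoining it
    creates no new invariant sets to exclude, since invariance under \<open>T\<close> implies
    invariance under \<open>S\<close>.\<close>
  define T where "T = insert ?e S"
  have T: "T \<in> comm_subsemigroups (sym_inv X)"
    unfolding T_def by (rule insert_one_in_comm_subsemigroups[OF S])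
  have "Y = {} \<or> Y = X" if "Y \<subseteq> X" "invariant_set T Y" for Y
    using that by (intro indec) (auto simp: invariant_set_def T_def)
  then obtain A where A: "A \<subseteq> X"
    and img: "\<And>\<alpha>. \<alpha> \<in> T - {?e} \<Longrightarrow> \<alpha> |` A \<in> partial_injections A (X - A)"
    and inj: "inj_on (\<lambda>\<alpha>. \<alpha> |` A) T"
    using indecomposable_embedding[OF fin T] T_def by blast
  have finT: "finite T"
    using T finite_partial_injections[OF fin fin] unfolding comm_subsemigroups_iff
    by (meson finite_subset)
  have finA: "finite A" "finite (X - A)" using fin A by (auto intro: finite_subset)
  have cA: "card A + card (X - A) = card X"
    using card_Diff_subset[OF finA(1) A] card_mono[OF fin A] by simp
  let ?I = "(\<lambda>\<alpha>. \<alpha> |` A) ` (T - {?e})"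
  have "card ?I = card (T - {?e})"
    by (intro card_image inj_on_subset[OF inj] Diff_subset)
  then have cT: "card T = card ?I + 1"
    using finT by (simp add: T_def card.insert_remove)
  have I: "?I \<subseteq> partial_injections A (X - A)" by (rule image_subsetI) (rule img)
  have cI: "card ?I \<le> pinj_num (card A) (card (X - A))"
    using card_mono[OF finite_partial_injections[OF finA] I] by (simp add: card_partial_injections finA)
  have cP: "pinj_num (card A) (card (X - A)) \<le> lambda_num (card X)"
    using pinj_num_le_lambda_num[of "card A" "card (X - A)"] cA by simp
  have cS: "card S \<le> card T" using finT by (intro card_mono) (auto simp: T_def)
  show "card S \<le> lambda_num (card X) + 1" using cS cT cI cP by linarith
  assume n: "10 \<le> card X" and "card S = lambda_num (card X) + 1"
  \<comment> \<open>Equality at the ends makes every inequality of the chain tight: the identity was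
    already in \<open>S\<close>, all partial injections occur as restrictions, and the split is
    balanced.\<close>
  then have "card S = card T" and ceq: "card ?I = pinj_num (card A) (card (X - A))"
    "pinj_num (card A) (card (X - A)) = lambda_num (card X)"
    using cS cT cI cP by linarith+
  then have ST: "S = T" using finT by (intro card_subset_eq) (auto simp: T_def)
  have onto: "?I = partial_injections A (X - A)"
    using I ceq(1) finite_partial_injections[OF finA]
    by (intro card_subset_eq) (auto simp: card_partial_injections finA)
  have bal: "card A = card X div 2 \<or> card (X - A) = card X div 2"
    using pinj_num_eq_lambda_numD[of "card A" "card (X - A)"] cA ceq(2) by simp
  then have "2 \<le> card A" using n cA by linarith
  then have "T - {?e} = partial_injections A (X - A)"
    by (rule indecomposable_extremal[OF T A]) (simp_all only: img onto order_refl)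
  then have "S = partial_injections A (X - A) \<union> {?e}" using ST T_def by blast
  moreover have "card A = card X div 2 \<or> card A = card X - card X div 2" using bal cA by linarith
  ultimately show "S \<in> balanced_null_monoids X"
    using A n unfolding balanced_null_monoids_eq[OF order.trans[OF _ n], simplified] by blast
qed

text \<open>Points of \<open>Y\<close> stay in \<open>Y\<close>, so restriction commutes with
  composition and preserves closure and commutativity.\<close>

lemma restrict_comm_subsemigroup:
  assumes S: "S \<in> comm_subsemigroups (sym_inv X)" and Y: "Y \<subseteq> X" and inv: "invariant_set S Y"
  shows "(\<lambda>\<alpha>. \<alpha> |` Y) ` S \<in> comm_subsemigroups (sym_inv Y)"
proof -
  have inv': "x \<in> Y \<longleftrightarrow> y \<in> Y" if "\<alpha> \<in> S" "\<alpha> x = Some y" for \<alpha> x y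
    using inv that by (auto simp: invariant_set_def)
  have comp: "(\<beta> |` Y) \<circ>\<^sub>m (\<alpha> |` Y) = (\<beta> \<circ>\<^sub>m \<alpha>) |` Y" if "\<alpha> \<in> S" for \<alpha> \<beta> :: "'a \<rightharpoonup> 'a"
  proof
    fix x show "((\<beta> |` Y) \<circ>\<^sub>m (\<alpha> |` Y)) x = ((\<beta> \<circ>\<^sub>m \<alpha>) |` Y) x"
      using inv'[OF that, of x] by (cases "\<alpha> x") (auto simp: map_comp_def restrict_map_def)
  qed
  have "\<alpha> |` Y \<in> partial_injections Y Y" if "\<alpha> \<in> S" for \<alpha>
  proof -
    have "\<alpha> \<in> partial_injections X X" using S that by (auto simp: comm_subsemigroups_iff)
    then show ?thesis using inv'[OF that]
      by (intro partial_injectionsI)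
        (auto simp: restrict_map_Some_iff dest: partial_injections_injD)
  qed
  then show ?thesis using S unfolding comm_subsemigroups_iff
    by (auto simp: comp)
qed

text \<open>Transfers equality in the product bound to both factors.\<close>

lemma mult_ge_imp_eq:
  fixes a b c d :: nat
  assumes "a \<le> c" "b \<le> d" "0 < c" "0 < d" "c * d \<le> a * b"
  shows "a = c \<and> b = d"
proof -
  have "c * d \<le> a * d" using assms by (meson le_trans mult_le_mono2)
  moreover have "c * d \<le> c * b" using assms by (meson le_trans mult_le_mono1)
  ultimately show ?thesis using assms by auto
qed

text \<open>The uniqueness claims are part of the induction because, below 10 points, uniqueness for
  a decomposable \<open>S\<close> rests on uniqueness for its two restrictions.\<close>

lemma comm_subsemigroup_bound:
  assumes "finite X" "X \<noteq> {}" "S \<in> comm_subsemigroups (sym_inv X)"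
  shows "card S \<le> comm_bound (card X) \<and>
    (card X < 10 \<longrightarrow> card S = comm_bound (card X) \<longrightarrow> S = idempotents (sym_inv X)) \<and>
    (10 \<le> card X \<longrightarrow> card S = comm_bound (card X) \<longrightarrow> S \<in> balanced_null_monoids X)"
  using assms
proof (induction X arbitrary: S rule: finite_psubset_induct)
  case (psubset X)
  note fin = \<open>finite X\<close> and S = psubset.prems(2)
  have n0: "0 < card X" using fin psubset.prems(1) by (simp add: card_gt_0_iff)
  have eqE: "S = idempotents (sym_inv X)"
    if "S \<subseteq> idempotents (sym_inv X)" "card S = 2 ^ card X"
  proof (rule card_subset_eq)
    show "finite (idempotents (sym_inv X))" by (simp add: idempotents_sym_inv fin)
  qed (simp_all only: that card_idempotents_sym_inv[OF fin])
  show ?case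
  proof (cases "\<forall>Y\<subseteq>X. invariant_set S Y \<longrightarrow> Y = {} \<or> Y = X")
    case True
    then have bound: "card S \<le> lambda_num (card X) + 1"
      "10 \<le> card X \<Longrightarrow> card S = lambda_num (card X) + 1 \<Longrightarrow> S \<in> balanced_null_monoids X"
      using indecomposable_bound[OF fin S] by blast+
    \<comment> \<open>With one point the bound for the indecomposable case equals
      \<open>2 ^ 1\<close>, so uniqueness is checked directly; from 2 to 9 points that bound lies
      strictly below the power of two.\<close>
    consider "10 \<le> card X" | "card X = 1" | "2 \<le> card X" "card X < 10" using n0 by linarith
    then show ?thesis
    proof cases
      case 1
      then show ?thesis using bound by (simp add: comm_bound_def)
    next
      case 2
      then obtain x where X: "X = {x}" by (auto simp: card_1_singleton_iff)
      have "S \<subseteq> idempotents (sym_inv X)"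
      proof
        fix \<alpha> assume "\<alpha> \<in> S"
        then have "\<alpha> \<in> partial_injections {x} {x}" using S X by (auto simp: comm_subsemigroups_iff)
        then have "\<alpha> = Some |` dom \<alpha>" "dom \<alpha> \<subseteq> X"
          by (auto simp: X restrict_map_def dom_def fun_eq_iff dest: partial_injections_SomeD)
        then show "\<alpha> \<in> idempotents (sym_inv X)" unfolding idempotents_sym_inv by blast
      qed
      then show ?thesis using eqE bound(1) 2 by (simp add: comm_bound_def)
    next
      case 3
      then have "lambda_num (card X) + 1 < 2 ^ card X" by (rule lambda_num_lt_power)
      then show ?thesis using bound(1) 3 by (simp add: comm_bound_def)
    qed
  next
    case False
    then obtain Y where Y: "Y \<subset> X" "Y \<noteq> {}" "invariant_set S Y" by blast
    define Z where "Z = X - Y"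
    have inX: "x \<in> X \<and> y \<in> X" if "\<alpha> \<in> S" "\<alpha> x = Some y" for \<alpha> x y
      using S that by (auto simp: comm_subsemigroups_iff dest: partial_injections_SomeD)
    have "x \<in> Z \<longleftrightarrow> y \<in> Z" if "\<alpha> \<in> S" "\<alpha> x = Some y" for \<alpha> x y
      using inX[OF that] Y(3) that unfolding Z_def invariant_set_def by simp
    then have Z: "Z \<subset> X" "Z \<noteq> {}" "invariant_set S Z"
      using Y(1,2) unfolding Z_def invariant_set_def by blast+
    let ?r = "\<lambda>Y. (\<lambda>\<alpha>. \<alpha> |` Y) ` S"
    note bY = psubset.IH[OF Y(1,2) restrict_comm_subsemigroup[OF S psubset_imp_subset[OF Y(1)] Y(3)]]
      and bZ = psubset.IH[OF Z(1,2) restrict_comm_subsemigroup[OF S psubset_imp_subset[OF Z(1)] Z(3)]]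
    have finYZ: "finite Y" "finite Z" using Y(1) Z(1) fin by (auto intro: finite_subset)
    have "0 < card Y" "0 < card Z"
      using Y(2) Z(2) finYZ by (simp_all only: card_gt_0_iff simp_thms)
    moreover have "card Z = card X - card Y"
      unfolding Z_def by (rule card_Diff_subset[OF finYZ(1) psubset_imp_subset[OF Y(1)]])
    ultimately have cYZ: "card X = card Y + card Z" "1 \<le> card Y" "1 \<le> card Z"
      by linarith+
    \<comment> \<open>Outside \<open>X\<close> both sides are \<open>None\<close>, so the two
      restrictions determine the map.\<close>
    have eq_on: "\<alpha> x = (if x \<in> Y then (\<alpha> |` Y) x else (\<alpha> |` Z) x)" if "\<alpha> \<in> S" for \<alpha> x
      using inX[OF that, of x] unfolding restrict_map_def Z_def by (cases "\<alpha> x") simp_all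
    have "inj_on (\<lambda>\<alpha>. (\<alpha> |` Y, \<alpha> |` Z)) S"
    proof (intro inj_onI ext)
      fix \<alpha> \<beta> x assume "\<alpha> \<in> S" "\<beta> \<in> S" "(\<alpha> |` Y, \<alpha> |` Z) = (\<beta> |` Y, \<beta> |` Z)"
      then show "\<alpha> x = \<beta> x"
        using eq_on[of \<alpha> x] eq_on[of \<beta> x] by (simp only: prod.inject)
    qed
    moreover have "(\<lambda>\<alpha>. (\<alpha> |` Y, \<alpha> |` Z)) ` S \<subseteq> ?r Y \<times> ?r Z"
      by (rule image_subsetI) (intro SigmaI imageI)
    moreover have "finite S"
      using S finite_subset[OF _ finite_partial_injections[OF fin fin]]
      unfolding comm_subsemigroups_iff by blast
    ultimately have prod: "card S \<le> card (?r Y) * card (?r Z)"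
      using card_inj_on_le[of "\<lambda>\<alpha>. (\<alpha> |` Y, \<alpha> |` Z)" S "?r Y \<times> ?r Z"]
      by (simp add: card_cartesian_product)
    also have "\<dots> \<le> comm_bound (card Y) * comm_bound (card Z)"
      using bY bZ by (intro mult_mono) simp_all
    finally have le: "card S \<le> comm_bound (card Y) * comm_bound (card Z)" .
    show ?thesis
    proof (cases "10 \<le> card X")
      case True
      \<comment> \<open>The strict inequality rules out equality, so a decomposable \<open>S\<close>
        is never extremal here.\<close>
      then show ?thesis using le comm_bound_mult_less[of "card Y" "card Z"] cYZ by simp
    next
      case n: False
      then have pow: "comm_bound (card X) = comm_bound (card Y) * comm_bound (card Z)"
        using cYZ by (simp add: comm_bound_def power_add)
      have "S = idempotents (sym_inv X)" if eq: "card S = comm_bound (card X)"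
      proof -
        have "card (?r Y) = comm_bound (card Y) \<and> card (?r Z) = comm_bound (card Z)"
        proof (rule mult_ge_imp_eq)
          show "comm_bound (card Y) * comm_bound (card Z) \<le> card (?r Y) * card (?r Z)"
            using prod eq pow by simp
        qed (use bY bZ in simp_all)
        then have idY: "?r Y = idempotents (sym_inv Y)" and idZ: "?r Z = idempotents (sym_inv Z)"
          using bY bZ n cYZ by simp_all
        have "S \<subseteq> idempotents (sym_inv X)"
        proof
          fix \<alpha> assume \<alpha>: "\<alpha> \<in> S"
          have "\<alpha> |` Y \<in> idempotents (sym_inv Y)" "\<alpha> |` Z \<in> idempotents (sym_inv Z)"
            unfolding idY[symmetric] idZ[symmetric] using \<alpha> by (rule imageI)+
          then obtain U V where UV: "U \<subseteq> Y" "V \<subseteq> Z" "\<alpha> |` Y = Some |` U" "\<alpha> |` Z = Some |` V"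
            unfolding idempotents_sym_inv by blast
          \<comment> \<open>Two partial identities on complementary blocks glue to a partial
            identity.\<close>
          have "\<alpha> = Some |` (U \<union> V)"
          proof
            fix x show "\<alpha> x = (Some |` (U \<union> V)) x"
              using eq_on[OF \<alpha>, of x] UV by (auto simp: restrict_map_def Z_def)
          qed
          moreover have "U \<union> V \<subseteq> X" using UV Y Z by blast
          ultimately show "\<alpha> \<in> idempotents (sym_inv X)" unfolding idempotents_sym_inv by blast
        qed
        then show ?thesis using eq n by (intro eqE) (simp_all add: comm_bound_def)
      qed
      then show ?thesis using le pow n by simp
    qed
  qed
qed

section \<open>Sharpness of the bound and the final classification\<close>

lemma balanced_null_monoid_extremal:
  assumes "2 \<le> card X" "M \<in> balanced_null_monoids X"
  shows "M \<in> comm_subsemigroups (sym_inv X)" "card M = lambda_num (card X) + 1"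
    and "\<exists>K. K \<subset> X \<and> M = partial_injections K (X - K) \<union> {Some |` X}"
proof -
  have fin: "finite X" using assms by (metis card.infinite not_numeral_le_zero)
  obtain K where K: "K \<subseteq> X" "card K = card X div 2 \<or> card K = card X - card X div 2"
    and M: "M = partial_injections K (X - K) \<union> {Some |` X}"
    using assms by (auto simp: balanced_null_monoids_eq)
  have "card K < card X" using K(2) assms(1) by linarith
  with K have KX: "K \<subset> X" by auto
  show "M \<in> comm_subsemigroups (sym_inv X)"
    unfolding M using K by (intro null_monoid_in_comm_subsemigroups) auto
  have "card (X - K) = card X - card K" using K fin by (simp add: card_Diff_subset finite_subset)
  then show "card M = lambda_num (card X) + 1"
    unfolding M using K(2) card_null_monoid[OF fin KX, of "X - K"]
    \<comment> \<open>Symmetry of \<open>pinj_num\<close> covers the case in which \<open>K\<close>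
      has size \<open>card X - card X div 2\<close>.\<close>
    by (auto simp: lambda_num_eq pinj_num_commute[of "card X - card X div 2"])
  show "\<exists>K. K \<subset> X \<and> M = partial_injections K (X - K) \<union> {Some |` X}" using KX M by blast
qed

theorem theorem5p3:
  fixes X :: "'a set" and n m :: nat
  assumes "finite X" and "card X = n" and "n \<ge> 1" and "m = n div 2"
  shows
    "(n < 10 \<longrightarrow>
        Max (card ` comm_subsemigroups (sym_inv X)) = 2 ^ n \<and>
        {S \<in> comm_subsemigroups (sym_inv X). card S = 2 ^ n} = {idempotents (sym_inv X)})
     \<and>
     (n \<ge> 10 \<longrightarrow>
        Max (card ` comm_subsemigroups (sym_inv X)) = lambda_num n + 1 \<and>
        lambda_num n + 1 = (\<Sum>r = 0..m. (m choose r) * ((n - m) choose r) * fact r) + 1 \<and>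
        (even n \<longrightarrow>
           {S \<in> comm_subsemigroups (sym_inv X). card S = lambda_num n + 1}
             = balanced_null_monoids X \<and>
           card {S \<in> comm_subsemigroups (sym_inv X). card S = lambda_num n + 1}
             = n choose m \<and>
           (\<forall>S \<in> comm_subsemigroups (sym_inv X). \<forall>T \<in> comm_subsemigroups (sym_inv X).
              card S = lambda_num n + 1 \<and> card T = lambda_num n + 1 \<longrightarrow>
              iso_subsemigroups (sym_inv X) S T)) \<and>
        (odd n \<longrightarrow>
           {S \<in> comm_subsemigroups (sym_inv X). card S = lambda_num n + 1}
             = balanced_null_monoids X \<and>
           card {S \<in> comm_subsemigroups (sym_inv X). card S = lambda_num n + 1}
             = 2 * (n choose m) \<and>
           (\<forall>S \<in> comm_subsemigroups (sym_inv X). \<forall>T \<in> comm_subsemigroups (sym_inv X).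
              card S = lambda_num n + 1 \<and> card T = lambda_num n + 1 \<longrightarrow>
              iso_subsemigroups (sym_inv X) S T)))"
proof -
  let ?G = "sym_inv X" and ?C = "comm_subsemigroups (sym_inv X)"
  have "X \<noteq> {}" using assms by auto
  note bound = comm_subsemigroup_bound[OF assms(1) this, unfolded assms(2)]
  \<comment> \<open>Any subsemigroup that attains the bound yields the maximum: the idempotents
    below 10 points, a balanced null monoid from 10 on.\<close>
  have Max_eq: "Max (card ` ?C) = card S" if "S \<in> ?C" "card S = comm_bound n" for S
  proof (rule Max_eqI)
    show "finite (card ` ?C)" using finite_comm_subsemigroups[OF assms(1)] by simp
    show "k \<le> card S" if "k \<in> card ` ?C" for k using that bound \<open>card S = _\<close> by fastforce
  qed (use that in blast)
  have small: "Max (card ` ?C) = 2 ^ n \<and> {S \<in> ?C. card S = 2 ^ n} = {idempotents ?G}" if "n < 10"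
  proof
    have E: "idempotents ?G \<in> ?C" "card (idempotents ?G) = 2 ^ n"
      using idempotents_in_comm_subsemigroups card_idempotents_sym_inv assms by auto
    have cb: "comm_bound n = 2 ^ n" using that by (simp add: comm_bound_def)
    show "Max (card ` ?C) = 2 ^ n" using Max_eq[OF E(1)] E(2) cb by simp
    have "S = idempotents ?G" if "S \<in> ?C" "card S = 2 ^ n" for S
      using bound[OF that(1)] that(2) \<open>n < 10\<close> cb by simp
    then show "{S \<in> ?C. card S = 2 ^ n} = {idempotents ?G}" using E by blast
  qed
  {
    assume n: "10 \<le> n"
    then have cb: "comm_bound n = lambda_num n + 1" by (simp add: comm_bound_def)
    have card_X: "2 \<le> card X" using n assms by simp
    note ext = balanced_null_monoid_extremal[OF card_X, unfolded assms(2)]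
    have eq: "{S \<in> ?C. card S = lambda_num n + 1} = balanced_null_monoids X"
    proof
      show "{S \<in> ?C. card S = lambda_num n + 1} \<subseteq> balanced_null_monoids X"
        using bound n cb by simp blast
      show "balanced_null_monoids X \<subseteq> {S \<in> ?C. card S = lambda_num n + 1}"
        using ext(1,2) by blast
    qed
    have card: "card (balanced_null_monoids X) = (if even n then 1 else 2) * (n choose m)"
      using card_balanced_null_monoids[OF card_X] assms by simp
    \<comment> \<open>The positive count provides a witness \<open>M\<close> that attains the
      maximum.\<close>
    then have "0 < card (balanced_null_monoids X)" using assms(4) by simp
    then obtain M where "M \<in> balanced_null_monoids X" by (metis all_not_in_conv card.empty less_irrefl)
    then have max: "Max (card ` ?C) = lambda_num n + 1"
      using Max_eq[of M] ext(1,2)[of M] cb by simp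
    have iso: "iso_subsemigroups ?G S T"
      if "S \<in> ?C" "T \<in> ?C" "card S = lambda_num n + 1" "card T = lambda_num n + 1" for S T
    proof -
      have "S \<in> balanced_null_monoids X" "T \<in> balanced_null_monoids X" using that eq by blast+
      then obtain K K' where K: "K \<subset> X" "S = partial_injections K (X - K) \<union> {Some |` X}"
        "K' \<subset> X" "T = partial_injections K' (X - K') \<union> {Some |` X}"
        using ext(3)[of S] ext(3)[of T] by blast
      show ?thesis unfolding K(2,4)
      proof (rule null_monoids_iso[OF assms(1)])
        show "card (partial_injections K (X - K) \<union> {Some |` X}) =
            card (partial_injections K' (X - K') \<union> {Some |` X})"
          using that(3,4) unfolding K(2,4) by (rule trans[OF _ sym])
      qed (use K(1,3) in blast)+
    qed
    have sum: "lambda_num n + 1 = (\<Sum>r = 0..m. (m choose r) * ((n - m) choose r) * fact r) + 1"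
      by (simp only: lambda_num_def assms(4))
    \<comment> \<open>Both parities are treated together, the factor 1 or 2 being kept in an
      \<open>if\<close> that is resolved at the end.\<close>
    have "Max (card ` ?C) = lambda_num n + 1 \<and>
        lambda_num n + 1 = (\<Sum>r = 0..m. (m choose r) * ((n - m) choose r) * fact r) + 1 \<and>
        {S \<in> ?C. card S = lambda_num n + 1} = balanced_null_monoids X \<and>
        card {S \<in> ?C. card S = lambda_num n + 1} = (if even n then 1 else 2) * (n choose m) \<and>
        (\<forall>S \<in> ?C. \<forall>T \<in> ?C. card S = lambda_num n + 1 \<and> card T = lambda_num n + 1 \<longrightarrow>
              iso_subsemigroups ?G S T)"
      using max sum eq card iso by (intro conjI ballI impI) (simp_all only:)
  }
  note large = this
  show ?thesis
  proof (cases "n < 10")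
    case True
    then show ?thesis using small by simp
  next
    case False
    then have "10 \<le> n" by simp
    note l = large[OF this]
    let ?c = "card {S \<in> ?C. card S = lambda_num n + 1}"
    have "?c = (if even n then 1 else 2) * (n choose m)" using l by blast
    then have "even n \<Longrightarrow> ?c = n choose m" "odd n \<Longrightarrow> ?c = 2 * (n choose m)"
      by (simp_all only: if_True if_False mult_1)
    then show ?thesis using l False by blast
  qed
qed

end
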